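(* Let $p$ be an odd prime. Then \[ \sum_{k=0}^{p-1}(205k^2+160k+32)(-1)^k\binom{2k}{k}^5\equiv 32p^2+64p^3H_{p-1}\pmod{p^7}\quad\text{for } p\neq5, \] and \[ \sum_{k=0}^{(p-1)/2}(205k^2+160k+32)(-1)^k\binom{2k}{k}^5\equiv 32p^2\pmod{p^5}\quad\text{for } p>3, \] where $H_{p-1}=\sum_{k=1}^{p-1}1/k$ and the congruences are understood in the ring of rationals with denominators prime to $p$. *)

theory Defs
  imports Complex_Main "HOL-Computational_Algebra.Primes"
begin

definition p_integral :: "nat \<Rightarrow> rat \<Rightarrow> bool" where
  "p_integral p x \<longleftrightarrow> coprime (int p) (snd (quotient_of x))"

definition qcong_pow :: "nat \<Rightarrow> nat \<Rightarrow> rat \<Rightarrow> rat \<Rightarrow> bool" where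
  "qcong_pow p n a b \<longleftrightarrow> p_integral p ((a - b) / of_nat (p ^ n))"

definition harm :: "nat \<Rightarrow> rat" where
  "harm n = (\<Sum>k=1..n. 1 / of_nat k)"

end

theory Submission
  imports Defs
begin

text \<open>
  The sum is transformed by the Wilf--Zeilberger method. The pair is dual to the one behind Amdeberhan
  and Zeilberger's series $\zeta(3) = \frac{1}{64}\sum_n (-1)^n (205n^2+250n+77)\, n!^{10}/(2n+1)!^5$.
  Telescoping shows that the partial sum up to $M$ equals $\sum_{i\le M}$ of
  $32 (-1)^{M+i} (2M+1)!^3 (2M+i+1)!^2 / (M!^6 (M-i)! (M+i+1)!^3)$.

  For $M = p-1$ this is $32p^2 C^5(1 + 4p^2\sum_i t_i)$, where
  $C = \binom{2p-1}{p-1} = \prod_l (1 - p^2/l^2) \equiv 1 - p^2 H^{(2)}$ modulo $p^5$ and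
  $\sum_i t_i \equiv H^{(2)}$ modulo $p^3$, with $H^{(2)} = \sum_{l<p} 1/l^2$. Since
  $pH^{(2)} \equiv -2H_{p-1}$ modulo $p^4$, the result is $32p^2(1 + 2pH_{p-1})$.
  For $M = (p-1)/2$ every term with $i < M$ is divisible by $p^5$, and the term $i = M$ is
  $32p^2\prod_{l\le M}(1 - p^2/l^2)^2$.
\<close>

section \<open>Congruences between $p$-integral rationals\<close>

text \<open>The reduced denominator divides every other denominator of the same fraction. Closure
  properties can thus be shown without reducing fractions.\<close>

lemma p_integral_iff:
  "p_integral p x \<longleftrightarrow> (\<exists>a b. b \<noteq> 0 \<and> coprime (int p) b \<and> x = of_int a / of_int b)"
proof
  assume "p_integral p x"
  moreover obtain a b where "quotient_of x = (a, b)" by fastforce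
  ultimately show "\<exists>a b. b \<noteq> 0 \<and> coprime (int p) b \<and> x = of_int a / of_int b"
    using quotient_of_div[of x a b] quotient_of_denom_pos[of x a b]
    by (intro exI[of _ a] exI[of _ b]) (auto simp: p_integral_def)
next
  assume "\<exists>a b. b \<noteq> 0 \<and> coprime (int p) b \<and> x = of_int a / of_int b"
  then obtain a b where ab: "b \<noteq> 0" "coprime (int p) b" "x = of_int a / of_int b" by blast
  obtain c d where cd: "quotient_of x = (c, d)" by fastforce
  have d: "d > 0" "coprime c d" "x = of_int c / of_int d"
    using cd quotient_of_denom_pos quotient_of_coprime quotient_of_div by blast+
  have "of_int (a * d) = (of_int (c * b) :: rat)"
    using ab d by (simp add: field_simps)
  hence "a * d = c * b" by (simp only: of_int_eq_iff)
  hence "d dvd b" using d(2) by (metis coprime_commute coprime_dvd_mult_right_iff dvd_triv_right)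
  hence "coprime (int p) d" using ab(2) coprime_divisors dvd_refl by blast
  thus "p_integral p x" by (simp add: p_integral_def cd)
qed

locale padic =
  fixes p :: nat
  assumes prime_p: "prime p"
begin

text \<open>\<open>J n\<close> is the ideal $p^n\mathbb{Z}_{(p)}$ in the ring \<open>J 0\<close> of $p$-integral rationals.\<close>

definition J :: "nat \<Rightarrow> rat set" where
  "J n = {x. p_integral p (x / of_nat p ^ n)}"

lemma p_pos: "p > 0" using prime_p prime_gt_0_nat by blast

lemma J_iff: "x \<in> J n \<longleftrightarrow> (\<exists>a b. b \<noteq> 0 \<and> coprime (int p) b \<and> x = of_nat p ^ n * of_int a / of_int b)"
  using p_pos by (auto simp: J_def p_integral_iff field_simps)

lemma qcong_pow_iff: "qcong_pow p n a b \<longleftrightarrow> a - b \<in> J n"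
  by (simp add: qcong_pow_def J_def)

lemma J_add: "x \<in> J n \<Longrightarrow> y \<in> J n \<Longrightarrow> x + y \<in> J n"
proof -
  assume "x \<in> J n" "y \<in> J n"
  then obtain a b c d where *: "b \<noteq> 0" "coprime (int p) b" "x = of_nat p ^ n * of_int a / of_int b"
    "d \<noteq> 0" "coprime (int p) d" "y = of_nat p ^ n * of_int c / of_int d"
    unfolding J_iff by blast
  hence "x + y = of_nat p ^ n * of_int (a * d + c * b) / of_int (b * d)"
    by (simp add: field_simps)
  moreover have "coprime (int p) (b * d)" using * by simp
  ultimately show ?thesis unfolding J_iff using * by (metis mult_eq_0_iff)
qed

lemma J_mult: "x \<in> J m \<Longrightarrow> y \<in> J n \<Longrightarrow> x * y \<in> J (m + n)"
proof -
  assume "x \<in> J m" "y \<in> J n"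
  then obtain a b c d where *: "b \<noteq> 0" "coprime (int p) b" "x = of_nat p ^ m * of_int a / of_int b"
    "d \<noteq> 0" "coprime (int p) d" "y = of_nat p ^ n * of_int c / of_int d"
    unfolding J_iff by blast
  hence "x * y = of_nat p ^ (m + n) * of_int (a * c) / of_int (b * d)"
    by (simp add: field_simps power_add)
  moreover have "coprime (int p) (b * d)" using * by simp
  ultimately show ?thesis unfolding J_iff using * by (metis mult_eq_0_iff)
qed

lemma J_mono: "x \<in> J n \<Longrightarrow> m \<le> n \<Longrightarrow> x \<in> J m"
proof -
  assume "x \<in> J n" "m \<le> n"
  then obtain a b where *: "b \<noteq> 0" "coprime (int p) b" "x = of_nat p ^ n * of_int a / of_int b"
    unfolding J_iff by blast
  moreover have "(of_nat p :: rat) ^ n = of_nat p ^ m * of_nat p ^ (n - m)"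
    using \<open>m \<le> n\<close> by (simp flip: power_add)
  ultimately have "x = of_nat p ^ m * of_int (int p ^ (n - m) * a) / of_int b"
    by simp
  thus ?thesis unfolding J_iff using * by blast
qed

lemma J_of_int [simp]: "of_int a \<in> J 0"
  unfolding J_iff by (intro exI[of _ a] exI[of _ 1]) auto

lemma J_of_nat [simp]: "of_nat a \<in> J 0"
  using J_of_int[of "int a"] by simp

lemma J_numeral [simp]: "numeral a \<in> J 0"
  using J_of_int[of "numeral a"] by simp

lemma J_one [simp]: "1 \<in> J 0"
  using J_of_int[of 1] by simp

lemma J_zero [simp]: "0 \<in> J n"
  unfolding J_iff by (intro exI[of _ 0] exI[of _ 1]) auto

lemma J_p_power [simp]: "of_nat p ^ n \<in> J n"
  unfolding J_iff by (intro exI[of _ 1]) auto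

lemma J_inverse: "\<not> p dvd l \<Longrightarrow> 1 / of_nat l \<in> J 0"
proof -
  assume *: "\<not> p dvd l"
  hence "coprime (int p) (int l)"
    using prime_p prime_imp_coprime_nat by auto
  moreover have "l \<noteq> 0" using * by (metis dvd_0_right)
  ultimately show ?thesis unfolding J_iff
    by (intro exI[of _ 1] exI[of _ "int l"]) auto
qed

lemma J_mult0: "x \<in> J 0 \<Longrightarrow> y \<in> J n \<Longrightarrow> x * y \<in> J n"
  "x \<in> J n \<Longrightarrow> y \<in> J 0 \<Longrightarrow> x * y \<in> J n"
  using J_mult[of x 0 y n] J_mult[of x n y 0] by auto

lemma J_numeral_mult: "x \<in> J n \<Longrightarrow> numeral c * x \<in> J n"
  by (rule J_mult0(1)) simp_all

lemma J_uminus: "x \<in> J n \<Longrightarrow> - x \<in> J n"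
  using J_mult0(1)[of "-1" x n] J_of_int[of "-1"] by simp

lemma J_diff: "x \<in> J n \<Longrightarrow> y \<in> J n \<Longrightarrow> x - y \<in> J n"
  using J_add[of x n "-y"] J_uminus[of y n] by simp

lemma J_power: "x \<in> J 0 \<Longrightarrow> x ^ k \<in> J 0"
  by (induction k) (auto intro: J_mult0)

lemma J_sum: "(\<And>i. i \<in> A \<Longrightarrow> f i \<in> J n) \<Longrightarrow> sum f A \<in> J n"
  by (induction A rule: infinite_finite_induct) (auto intro: J_add)

lemma J_cancel_nat:
  assumes "of_nat c * x \<in> J n" "\<not> p dvd c"
  shows "x \<in> J n"
proof -
  have "c \<noteq> 0" using assms(2) by (metis dvd_0_right)
  hence "x = (1 / of_nat c) * (of_nat c * x)" by simp
  thus ?thesis using J_mult0(1)[OF J_inverse[OF assms(2)] assms(1)] by simp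
qed

end

section \<open>The WZ pair\<close>

text \<open>The transformed summand. As \<open>M - i\<close> is truncated, it is meaningful only for
  \<open>i \<le> M\<close>; beyond that it does not become 0.\<close>

definition wz_sum_term :: "nat \<Rightarrow> nat \<Rightarrow> rat" where
  "wz_sum_term M i = 32 * (-1) ^ (M + i) * fact (2*M+1) ^ 3 * fact (2*M+i+1) ^ 2 /
     (fact M ^ 6 * fact (M - i) * fact (M+1+i) ^ 3)"

text \<open>At \<open>N = i = 0\<close> the denominator vanishes, so the certificate is meaningful only for \<open>N > 0\<close>.\<close>

definition wz_cert :: "nat \<Rightarrow> nat \<Rightarrow> rat" where
  "wz_cert N i = 4 * (-1) ^ (N + i) * fact (2*N) ^ 3 * fact (2*N+i) ^ 2 *
     of_nat (N^2*(205*N^2+160*N+32) + N*(287*N^2+192*N+32)*i + (135*N^2+72*N+8)*i^2 + (21*N+8)*i^3) /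
     (of_nat (2*N+i)^2 * fact N ^ 6 * fact (N - i) * fact (N+i) ^ 3)"


text \<open>The Wilf-Zeilberger equation divided by \<open>wz_sum_term M i\<close> and cleared of
  denominators, up to sign, with \<open>N = M + 1\<close> and \<open>j = i\<close>; \<open>Q\<close>
  is the polynomial in \<open>wz_cert\<close>.\<close>

lemma wz_identity:
  fixes N j :: rat
  defines "Q \<equiv> \<lambda>j. N^2*(205*N^2+160*N+32) + N*(287*N^2+192*N+32)*j + (135*N^2+72*N+8)*j^2 + (21*N+8)*j^3"
  shows "8*(2*N+1)^3*(2*N+j)^2*(2*N+j+1)^2 + N^3*(N-j)*(N+j+1)^3 =
           Q j*(N+j+1)^3 + (2*N+j)^2*(N-j)*Q (j+1)"
  unfolding Q_def by algebra

text \<open>All four terms are rational multiples of \<open>wz_sum_term M i\<close>, which leaves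
  the polynomial identity above.\<close>

lemma wz_pair:
  assumes "i \<le> M"
  shows "wz_sum_term (Suc M) i - wz_sum_term M i = wz_cert (Suc M) i - wz_cert (Suc M) (Suc i)"
proof -
  \<comment> \<open>This removes truncated subtraction: \<open>M - i\<close> and
    \<open>Suc M - Suc i\<close> are both \<open>k\<close>.\<close>
  obtain k where M: "M = i + k" using assms le_Suc_ex by blast
  define A :: rat where "A = fact (2*M+1)"
  define B :: rat where "B = fact (2*M+1+i)"
  define C :: rat where "C = fact M"
  define D :: rat where "D = fact k"
  define E :: rat where "E = fact (M+1+i)"
  define s :: rat where "s = (-1) ^ (M + i)"
  define N :: rat where "N = of_nat M + 1"
  define j :: rat where "j = of_nat i"
  define K where "K = 32 * s * A^3 * B^2 / (C^6 * D * E^3)"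
  define Q where "Q = (\<lambda>j. N^2*(205*N^2+160*N+32) + N*(287*N^2+192*N+32)*j + (135*N^2+72*N+8)*j^2 + (21*N+8)*j^3)"
  have nz: "C \<noteq> 0" "D \<noteq> 0" "E \<noteq> 0" by (simp_all add: C_def D_def E_def)
  have pos: "N > 0" "j \<ge> 0" "N - j > 0" by (simp_all add: N_def j_def M)
  hence nz': "N \<noteq> 0" "N - j \<noteq> 0" "N + j + 1 \<noteq> 0" "2*N+j \<noteq> 0" "2*N+j+1 \<noteq> 0" by linarith+
  have f: "fact (2*M+3) = A * (2*N) * (2*N+1)" "fact (2*M+2) = A * (2*N)"
      "fact (2*M+i+3) = B * (2*N+j) * (2*N+j+1)" "fact (2*M+i+2) = B * (2*N+j)"
      "fact (Suc M) = C * N" "fact (Suc M - i) = D * (N - j)" "fact (M + i + 2) = E * (N+j+1)"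
    by (simp_all add: A_def B_def C_def D_def E_def N_def j_def M numeral_eq_Suc Suc_diff_le algebra_simps del: mult_Suc mult_Suc_right)
  have 1: "wz_sum_term M i = K"
    unfolding wz_sum_term_def K_def by (simp add: A_def B_def C_def D_def E_def s_def M add_ac)
  have "wz_sum_term (Suc M) i = 32 * (-s) * fact (2*M+3)^3 * fact (2*M+i+3)^2 / (fact (Suc M)^6 * fact (Suc M - i) * fact (M+i+2)^3)"
    unfolding wz_sum_term_def s_def by (simp add: numeral_eq_Suc)
  also have "\<dots> = - K * (8*(2*N+1)^3*(2*N+j)^2*(2*N+j+1)^2 / (N^3*(N-j)*(N+j+1)^3))"
    unfolding f K_def using nz nz' by (simp add: divide_simps)
  finally have 2: "wz_sum_term (Suc M) i = \<dots>" .

  define P where "P = (\<lambda>N i. N^2*(205*N^2+160*N+32) + N*(287*N^2+192*N+32)*i + (135*N^2+72*N+8)*i^2 + (21*N+8)*i^3 :: nat)"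
  have Nj: "of_nat (Suc M) = N" "of_nat (Suc i) = j + 1" "of_nat i = j" by (simp_all add: N_def j_def)
  have P: "of_nat (P (Suc M) i) = Q j" "of_nat (P (Suc M) (Suc i)) = Q (j + 1)"
    unfolding P_def Q_def of_nat_add of_nat_mult of_nat_power of_nat_numeral Nj by simp_all
  have "wz_cert (Suc M) i = 4 * (-s) * fact (2*M+2)^3 * fact (2*M+i+2)^2 * of_nat (P (Suc M) i) /
      ((2*N+j)^2 * fact (Suc M)^6 * fact (Suc M - i) * E^3)"
    unfolding wz_cert_def s_def P_def by (simp add: N_def j_def E_def add_ac)
  also have "\<dots> = - K * (Q j / (N^3*(N-j)))"
    unfolding f P K_def using nz nz' by (simp add: divide_simps)
  finally have 3: "wz_cert (Suc M) i = \<dots>" .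
  have "wz_cert (Suc M) (Suc i) = 4 * s * fact (2*M+2)^3 * fact (2*M+i+3)^2 * of_nat (P (Suc M) (Suc i)) /
      ((2*N+j+1)^2 * fact (Suc M)^6 * D * fact (M+i+2)^3)"
  proof -
    have "2 * Suc M = 2*M+2" "2 * Suc M + Suc i = 2*M+i+3" "Suc M - Suc i = k" "Suc M + Suc i = M+i+2"
      by (simp_all add: M)
    moreover have "of_nat (2*M+i+3) = 2*N+j+1" "(-1) ^ (M+i+2) = s"
      by (simp_all add: N_def j_def s_def)
    ultimately show ?thesis unfolding wz_cert_def P_def D_def by metis
  qed
  also have "\<dots> = K * ((2*N+j)^2 * Q (j+1) / (N^3*(N+j+1)^3))"
    unfolding f P K_def using nz nz' by (simp add: divide_simps)
  finally have 4: "wz_cert (Suc M) (Suc i) = \<dots>" .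
  have "8*(2*N+1)^3*(2*N+j)^2*(2*N+j+1)^2 / (N^3*(N-j)*(N+j+1)^3) + 1
      = Q j / (N^3*(N-j)) + (2*N+j)^2 * Q (j+1) / (N^3*(N+j+1)^3)"
    (is "?X / _ + 1 = ?Y / _ + ?Z / _")
  proof -
    \<comment> \<open>The variables \<open>a\<close>, \<open>b\<close>, \<open>c\<close> stand for
      \<open>N^3\<close>, \<open>N - j\<close>, \<open>(N+j+1)^3\<close> and keep these from being
      expanded.\<close>
    have *: "x / (a*b*c) + 1 = y / (a*b) + z / (a*c)"
      if "x + a*b*c = y*c + b*z" "a \<noteq> 0" "b \<noteq> 0" "c \<noteq> 0" for x y z a b c :: rat
    proof -
      have "x / (a*b*c) + 1 = (x + a*b*c) / (a*b*c)" using that(2-4) by (simp add: field_simps)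
      also have "\<dots> = y / (a*b) + z / (a*c)" unfolding that(1) using that(2-4) by (simp add: field_simps)
      finally show ?thesis .
    qed
    show ?thesis
    proof (rule *)
      show "?X + N^3 * (N-j) * (N+j+1)^3 = Q j * (N+j+1)^3 + (N-j) * ?Z"
        using wz_identity[of N j] unfolding Q_def by (simp only: mult_ac)
    qed (use nz' in simp_all)
  qed
  hence "K * (?X / (N^3*(N-j)*(N+j+1)^3) + 1) = K * (?Y / (N^3*(N-j)) + ?Z / (N^3*(N+j+1)^3))"
    by simp
  thus ?thesis unfolding 1 2 3 4 by (simp only: distrib_left minus_mult_left[symmetric] mult_1_right)
qed

text \<open>Row \<open>M\<close> has one term more than row \<open>M - 1\<close>; this term cancels
  the far end of the telescoping sum. At \<open>i = N\<close> the certificate polynomial factors as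
  \<open>72 * N^2 * (3*N+1)^2\<close>.\<close>

lemma wz_cert_diag:
  assumes "M > 0"
  shows "wz_sum_term M M = wz_cert M M"
proof -
  define N :: rat where "N = of_nat M"
  define A :: rat where "A = fact (2*M)"
  define B :: rat where "B = fact (3*M)"
  have N: "N > 0" using assms by (simp add: N_def)
  have A: "A \<noteq> 0" by (simp add: A_def)
  have f: "fact (2*M+1) = A * (2*N+1)" "fact (2*M+M+1) = B * (3*N+1)"
    "fact (M+1+M) = A * (2*N+1)" "fact (2*M+M) = B" "fact (2*M) = A" "fact (M+M) = A"
  proof -
    have "2*M+1 = Suc (2*M)" "2*M+M+1 = Suc (3*M)" "M+1+M = Suc (2*M)" "2*M+M = 3*M" "M+M = 2*M"
      by simp_all
    thus "fact (2*M+1) = A * (2*N+1)" "fact (2*M+M+1) = B * (3*N+1)"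
      "fact (M+1+M) = A * (2*N+1)" "fact (2*M+M) = B" "fact (2*M) = A" "fact (M+M) = A"
      unfolding A_def B_def N_def by (simp_all only: fact_Suc) (simp_all add: mult.commute)
  qed
  define P where "P = M^2*(205*M^2+160*M+32) + M*(287*M^2+192*M+32)*M + (135*M^2+72*M+8)*M^2 + (21*M+8)*M^3"
  have P: "of_nat P = 72 * N^2 * (3*N+1)^2"
    unfolding P_def of_nat_add of_nat_mult of_nat_power of_nat_numeral N_def[symmetric] by algebra
  have "(-1) ^ (M + M) = (1 :: rat)" by (simp flip: mult_2)
  hence "wz_sum_term M M = 32 * (A * (2*N+1))^3 * (B * (3*N+1))^2 / (fact M ^ 6 * (A * (2*N+1))^3)"
    unfolding wz_sum_term_def f by simp
  also have "\<dots> = 32 * (B * (3*N+1))^2 / fact M ^ 6"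
    using A N by simp
  also have "\<dots> = 4 * A^3 * B^2 * (72 * N^2 * (3*N+1)^2) / ((3*N)^2 * fact M ^ 6 * A^3)"
    using A N by (simp add: power_mult_distrib)
  also have "\<dots> = wz_cert M M"
    unfolding wz_cert_def P_def[symmetric] P f \<open>(-1) ^ (M + M) = 1\<close> by (simp add: N_def)
  finally show ?thesis .
qed

text \<open>The near end of the telescoping sum is the original summand: at \<open>i = 0\<close> the
  polynomial keeps only its first part, whose \<open>N^2\<close> cancels against
  \<open>(2*N)^2\<close>.\<close>

lemma wz_cert_0:
  assumes "M > 0"
  shows "wz_cert M 0 = of_nat (205*M^2 + 160*M + 32) * (-1)^M * of_nat ((2*M) choose M) ^ 5"
proof -
  define N :: rat where "N = of_nat M"
  define A :: rat where "A = fact (2*M)"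
  define B :: rat where "B = fact M"
  define P where "P = 205*M^2 + 160*M + 32"
  have nz: "N \<noteq> 0" "B \<noteq> 0" using assms by (simp_all add: N_def B_def)
  have "of_nat ((2*M) choose M) = A / (B * B)"
    using binomial_fact[of M "2*M", where ?'a = rat] by (simp add: mult_2 A_def B_def)
  hence *: "of_nat ((2*M) choose M) ^ 5 = (A / (B * B)) ^ 5" by simp
  have "wz_cert M 0 = 4 * (-1)^M * A^3 * A^2 * (N^2 * of_nat P) / ((2*N)^2 * B^6 * B * B^3)"
    unfolding wz_cert_def P_def A_def B_def N_def by (simp del: of_nat_add)
  also have "\<dots> = of_nat P * (-1)^M * (A / (B * B)) ^ 5"
    using nz by (simp add: field_simps flip: power_Suc)
  finally show ?thesis unfolding * P_def .
qed

text \<open>Passing from row \<open>M\<close> to row \<open>Suc M\<close> adds a telescoping sum and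
  the diagonal term, which together leave \<open>wz_cert (Suc M) 0\<close>.\<close>

lemma sum_eq_wz_sum:
  "(\<Sum>k=0..M. of_nat (205*k^2 + 160*k + 32) * (-1)^k * (of_nat ((2*k) choose k))^5) =
   (\<Sum>i\<le>M. wz_sum_term M i)"
proof (induction M)
  case 0
  show ?case by (simp add: wz_sum_term_def)
next
  case (Suc M)
  have "(\<Sum>i\<le>Suc M. wz_sum_term (Suc M) i) =
        (\<Sum>i\<le>M. wz_sum_term M i) + (\<Sum>i\<le>M. wz_cert (Suc M) i - wz_cert (Suc M) (Suc i)) + wz_cert (Suc M) (Suc M)"
    by (simp add: wz_cert_diag flip: sum.distrib wz_pair)
  also have "(\<Sum>i\<le>M. wz_cert (Suc M) i - wz_cert (Suc M) (Suc i)) = wz_cert (Suc M) 0 - wz_cert (Suc M) (Suc M)"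
    by (simp add: sum_telescope)
  finally show ?case using Suc by (simp add: wz_cert_0)
qed


section \<open>Ratios of consecutive terms and products of factorials\<close>

lemma wz_sum_term_Suc:
  assumes "i < M"
  shows "wz_sum_term M (Suc i) =
    - wz_sum_term M i * (of_nat (2*M+i+2)^2 * of_nat (M - i) / of_nat (M+i+2)^3)"
proof -
  obtain k where M: "M = i + Suc k" using assms less_iff_Suc_add by auto
  have *: "2*M + Suc i + 1 = Suc (2*M+i+1)" "M + 1 + Suc i = Suc (M+1+i)" "M - Suc i = k" "M - i = Suc k"
    using M by simp_all
  have **: "of_nat (Suc (2*M+i+1)) = (of_nat (2*M+i+2) :: rat)"
    "of_nat (Suc (M+1+i)) = (of_nat (M+i+2) :: rat)" by simp_all
  define A :: rat where "A = of_nat (2*M+i+2)"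
  define B :: rat where "B = of_nat (M+i+2)"
  define C :: rat where "C = of_nat (Suc k)"
  have "B \<noteq> 0" "C \<noteq> 0" by (simp_all add: B_def C_def)
  thus ?thesis
    unfolding wz_sum_term_def * fact_Suc ** of_nat_id A_def[symmetric] B_def[symmetric] C_def[symmetric]
    by (simp add: power_mult_distrib mult_ac)
qed

lemma prod_add_fact: "(\<Prod>l=1..n. of_nat p + of_nat l) = (fact (p + n) / fact p :: rat)"
  by (induction n) (simp_all add: add_ac mult_ac)

lemma prod_diff_fact:
  "n < p \<Longrightarrow> (\<Prod>l=1..n. of_nat p - of_nat l) = (fact (p - 1) / fact (p - 1 - n) :: rat)"
proof (induction n)
  case (Suc n)
  then obtain k where p: "p = Suc (Suc (n + k))" using less_iff_Suc_add by auto
  have "(of_nat p - of_nat (Suc n) :: rat) = of_nat (Suc k)" by (simp add: p)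
  moreover have "(of_nat (Suc k) :: rat) \<noteq> 0" by (simp only: of_nat_eq_0_iff)
  ultimately show ?case using Suc by (simp add: p)
qed simp

section \<open>Power sums of reciprocals\<close>

text \<open>Powers of \<open>1 / l\<close> are used so that integrality passes from
  \<open>1 / l\<close> to every exponent by \<open>J_power\<close>.\<close>

definition hsum :: "nat \<Rightarrow> nat \<Rightarrow> rat" where
  "hsum k n = (\<Sum>l=1..n. (1 / of_nat l) ^ k)"

lemma hsum_0 [simp]: "hsum k 0 = 0"
  by (simp add: hsum_def)

lemma hsum_Suc: "hsum k (Suc n) = hsum k n + (1 / of_nat (Suc n)) ^ k"
  by (simp add: hsum_def)

text \<open>\<open>(hsum 2 n ^ 2 - hsum 4 n) / 2\<close> is the second elementary symmetric function of the \<open>1 / l\<^sup>2\<close>.\<close>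

lemma hsum_e2_Suc:
  "(hsum 2 (Suc n) ^ 2 - hsum 4 (Suc n)) / 2 =
   (hsum 2 n ^ 2 - hsum 4 n) / 2 + hsum 2 n * (1 / of_nat (Suc n)) ^ 2"
proof -
  have "((h + x^2)^2 - (k + x^4)) / 2 = (h^2 - k) / 2 + h * x^2" for h k x :: rat
    by (simp add: field_simps power2_eq_square power4_eq_xxxx)
  thus ?thesis unfolding hsum_Suc by blast
qed

text \<open>The second elementary symmetric function with its pairs \<open>l < i\<close> grouped by
  the larger index.\<close>

lemma sum_hsum2_div_square:
  "(\<Sum>i=1..n. (1 / of_nat i)^2 * hsum 2 (i - 1)) = (hsum 2 n ^ 2 - hsum 4 n) / 2"
proof (induction n)
  case (Suc n)
  have "(\<Sum>i=1..Suc n. (1 / of_nat i)^2 * hsum 2 (i - 1)) =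
      (\<Sum>i=1..n. (1 / of_nat i)^2 * hsum 2 (i - 1)) + hsum 2 n * (1 / of_nat (Suc n)) ^ 2"
    by simp
  thus ?case by (simp only: Suc hsum_e2_Suc)
qed simp

lemma sum_reflect_half:
  "(\<Sum>l=1..2*m. f l) = (\<Sum>j=1..m. f j + f (2*m+1-j))" for f :: "nat \<Rightarrow> 'a::comm_monoid_add"
proof -
  have "(\<Sum>l=1..2*m. f l) = (\<Sum>l=1..m. f l) + (\<Sum>l=m+1..2*m. f l)"
    using sum.ub_add_nat[of 1 m f m] by (simp add: mult_2)
  also have "(\<Sum>l=m+1..2*m. f l) = (\<Sum>j=1..m. f (2*m+1-j))"
    by (rule sum.reindex_bij_witness[of _ "\<lambda>j. 2*m+1-j" "\<lambda>j. 2*m+1-j"]) auto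
  finally show ?thesis by (simp add: sum.distrib)
qed

text \<open>Odd indices are written so that, for \<open>p = 2*m+1\<close>, each is the reflection
  \<open>p - 2*j\<close> of an even one.\<close>

lemma sum_even_odd:
  "(\<Sum>l=1..2*m. f l) = (\<Sum>j=1..m. f (2*j) + f (2*m+1-2*j))" for f :: "nat \<Rightarrow> 'a::comm_monoid_add"
proof -
  have "(\<Sum>l=1..2*m. f l) = (\<Sum>j=1..m. f (2*j)) + (\<Sum>j=1..m. f (2*j-1))"
    by (induction m) (simp_all add: add_ac)
  also have "(\<Sum>j=1..m. f (2*j-1)) = (\<Sum>j=1..m. f (2*m+1-2*j))"
    by (rule sum.reindex_bij_witness[of _ "\<lambda>j. m+1-j" "\<lambda>j. m+1-j"]) (auto simp: diff_mult_distrib2 algebra_simps)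
  finally show ?thesis by (simp add: sum.distrib)
qed

context padic
begin

abbreviation P :: rat where "P \<equiv> of_nat p"

section \<open>Arithmetic of congruences modulo powers of \<open>p\<close>\<close>

lemma J_trans: "a - b \<in> J n \<Longrightarrow> b - c \<in> J n \<Longrightarrow> a - c \<in> J n"
  using J_add[of "a - b" n "b - c"] by simp

lemma J_cong_integral: "a - b \<in> J n \<Longrightarrow> b \<in> J 0 \<Longrightarrow> a \<in> J 0"
  using J_add[of "a - b" 0 b] J_mono[of "a - b" n 0] by simp

lemma J_cong_mult:
  assumes "a - b \<in> J n" "c - d \<in> J n" "b \<in> J 0" "c \<in> J 0"
  shows "a * c - b * d \<in> J n"
proof -
  have "a * c - b * d = (a - b) * c + b * (c - d)" by (simp add: algebra_simps)
  thus ?thesis using assms by (simp add: J_add J_mult0)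
qed

lemma J_cong_power:
  assumes "a - b \<in> J n" "a \<in> J 0" "b \<in> J 0"
  shows "a ^ k - b ^ k \<in> J n"
proof (induction k)
  case (Suc k)
  show ?case using J_cong_mult[OF assms(1) Suc assms(3) J_power[OF assms(2)]] by simp
qed simp

lemma J_P_power_mult: "x \<in> J n \<Longrightarrow> P ^ k * x \<in> J (k + n)"
  by (rule J_mult) simp_all

lemma J_P_mult: "x \<in> J n \<Longrightarrow> P * x \<in> J (Suc n)"
  using J_P_power_mult[of x n 1] by simp

lemma not_dvd: "1 \<le> l \<Longrightarrow> l < p \<Longrightarrow> \<not> p dvd l"
  using dvd_imp_le by fastforce

lemma inv_J: "1 \<le> l \<Longrightarrow> l < p \<Longrightarrow> 1 / of_nat l \<in> J 0"
  by (intro J_inverse not_dvd)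

lemma hsum_J: "n < p \<Longrightarrow> hsum k n \<in> J 0"
  unfolding hsum_def by (intro J_sum J_power inv_J) auto

lemma inv_fact_J: "n < p \<Longrightarrow> 1 / fact n \<in> J 0"
  using J_inverse[of "fact n"] prime_dvd_fact_iff[OF prime_p, of n] by simp

text \<open>The reciprocal of \<open>p - l\<close> recurs on the right with an extra factor
  \<open>P\<close>, so repeated substitution expands it in powers of \<open>P\<close> with an exact
  remainder.\<close>

lemma inverse_reflect: "1 \<le> l \<Longrightarrow> l < p \<Longrightarrow> 1 / of_nat (p - l) = - (1 / of_nat l) + P * (1 / of_nat l) * (1 / of_nat (p - l))"
  by (simp add: of_nat_diff field_simps)

text \<open>Modulo \<open>p\<close> the index \<open>p - l\<close> is \<open>-l\<close>, and an even
  exponent absorbs the sign.\<close>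

lemma inverse_reflect_power:
  assumes "1 \<le> l" "l < p" "even k"
  shows "(1 / of_nat (p - l)) ^ k - (1 / of_nat l) ^ k \<in> J 1"
proof -
  have ab: "1 / of_nat l \<in> J 0" "1 / of_nat (p - l) \<in> J 0"
    by (intro inv_J; use assms in linarith)+
  have "1 / of_nat (p - l) - (- (1 / of_nat l)) = P * ((1 / of_nat l) * (1 / of_nat (p - l)))"
    using inverse_reflect[OF assms(1,2)] unfolding diff_eq_eq by (simp only: mult.assoc add.commute)
  also have "\<dots> \<in> J 1" using J_P_mult[OF J_mult0(1)[OF ab]] by simp
  finally have "(1 / of_nat (p - l)) ^ k - (- (1 / of_nat l)) ^ k \<in> J 1"
    using ab by (intro J_cong_power J_uminus)
  thus ?thesis using assms(3) by simp
qed

section \<open>Divisibility of even power sums of reciprocals\<close>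

lemma not_dvd_2: "odd p \<Longrightarrow> \<not> p dvd 2"
  using prime_p primes_dvd_imp_eq two_is_prime_nat by blast

lemma J_half: "odd p \<Longrightarrow> x \<in> J n \<Longrightarrow> x / 2 \<in> J n"
  using J_cancel_nat[of 2 "x / 2" n] not_dvd_2 by simp

text \<open>
  Splitting \<open>{1..p-1}\<close> into two halves gives \<open>2 h\<close> for \<open>h = hsum k m\<close>, splitting it by parity gives
  \<open>2 h / 2^k\<close>; comparing the two forces \<open>h\<close> to vanish modulo \<open>p\<close>.
\<close>

lemma hsum_even_cong:
  assumes "p = 2*m+1" "even k" "\<not> p dvd 2^k - 1"
  shows "hsum k m \<in> J 1" "hsum k (p - 1) \<in> J 1"
proof -
  have p1: "p - 1 = 2*m" using assms by simp
  have a: "hsum k (p - 1) - 2 * hsum k m \<in> J 1"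
  proof -
    have "hsum k (p - 1) - 2 * hsum k m = (\<Sum>j=1..m. (1 / of_nat (p - j)) ^ k - (1 / of_nat j) ^ k)"
      unfolding hsum_def p1 sum_reflect_half assms(1)[symmetric] by (simp add: sum.distrib sum_subtractf)
    also have "\<dots> \<in> J 1"
      using assms by (intro J_sum inverse_reflect_power) auto
    finally show ?thesis .
  qed
  have b: "hsum k (p - 1) - 2 * (1/2)^k * hsum k m \<in> J 1"
  proof -
    have "hsum k (p - 1) - 2 * (1/2)^k * hsum k m = (\<Sum>j=1..m. (1 / of_nat (p - 2*j)) ^ k - (1 / of_nat (2*j)) ^ k)"
      unfolding hsum_def p1 sum_even_odd assms(1)[symmetric]
      by (simp add: sum.distrib sum_subtractf sum_distrib_left power_divide power_mult_distrib)
    also have "\<dots> \<in> J 1"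
      using assms by (intro J_sum inverse_reflect_power) auto
    finally show ?thesis .
  qed
  \<comment> \<open>The factor \<open>2^k\<close> clears \<open>(1/2)^k\<close>; the full sum
    cancels and \<open>2 * (2^k - 1)\<close> times the half sum remains.\<close>
  have c: "2 ^ k * ((hsum k (p - 1) - 2 * (1/2)^k * hsum k m) - (hsum k (p - 1) - 2 * hsum k m)) \<in> J 1"
    by (intro J_mult0(1) J_diff a b J_power) simp_all
  have "2 ^ k * ((hsum k (p - 1) - 2 * (1/2)^k * hsum k m) - (hsum k (p - 1) - 2 * hsum k m))
      = of_nat (2 * (2^k - 1)) * hsum k m"
    by (simp add: of_nat_diff power_divide field_simps)
  hence "of_nat (2 * (2^k - 1)) * hsum k m \<in> J 1" using c by (simp only:)
  moreover have "\<not> p dvd 2 * (2^k - 1)"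
  proof -
    have "odd p" using assms(1) by simp
    thus ?thesis using assms(3) not_dvd_2 prime_dvd_mult_iff[OF prime_p] by blast
  qed
  ultimately show h: "hsum k m \<in> J 1" by (rule J_cancel_nat)
  show "hsum k (p - 1) \<in> J 1"
    using J_add[OF a J_numeral_mult[OF h, of "num.Bit0 num.One"]] by simp
qed

section \<open>Products of \<open>1 - p^2 / l^2\<close> and a central binomial coefficient\<close>

lemma prod_one_minus_square:
  assumes "odd p" "n < p"
  shows "(\<Prod>l=1..n. 1 - P^2 * (1 / of_nat l)^2) -
     (1 - P^2 * hsum 2 n + P^4 * ((hsum 2 n ^ 2 - hsum 4 n) / 2)) \<in> J 6"
  using assms(2)
proof (induction n)
  case (Suc n)
  define x :: rat where "x = (1 / of_nat (Suc n))^2"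
  define h where "h = hsum 2 n"
  define e where "e = (hsum 2 n ^ 2 - hsum 4 n) / 2"
  define r where "r = (\<Prod>l=1..n. 1 - P^2 * (1 / of_nat l)^2) - (1 - P^2 * h + P^4 * e)"
  have r: "r \<in> J 6" using Suc by (simp add: r_def h_def e_def)
  have x: "x \<in> J 0" using Suc.prems inv_J[of "Suc n"] unfolding x_def by (intro J_power) simp
  have e: "e \<in> J 0"
    unfolding e_def using Suc.prems by (intro J_half assms J_diff J_power hsum_J) simp_all
  have e': "(hsum 2 (Suc n) ^ 2 - hsum 4 (Suc n)) / 2 = e + h * x"
    unfolding hsum_e2_Suc x_def e_def h_def ..
  have h': "hsum 2 (Suc n) = h + x" by (simp add: hsum_Suc x_def h_def)
  have "(\<Prod>l=1..Suc n. 1 - P^2 * (1 / of_nat l)^2) = (r + (1 - P^2 * h + P^4 * e)) * (1 - P^2 * x)"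
    by (simp add: r_def x_def)
  \<comment> \<open>Besides the old error \<open>r\<close>, the extra factor overflows the expansion
    only in \<open>P^6\<close>.\<close>
  hence "(\<Prod>l=1..Suc n. 1 - P^2 * (1 / of_nat l)^2) - (1 - P^2 * (h + x) + P^4 * (e + h * x))
     = r * (1 - P^2 * x) - P^6 * (e * x)"
    by algebra
  also have "\<dots> \<in> J 6"
    using J_P_power_mult[of "e * x" 0 6] e x r by (intro J_diff J_mult0(2)) (auto intro!: J_diff J_mult0 J_power)
  finally show ?case unfolding e' unfolding h' .
qed simp

text \<open>Each factor is \<open>-(p - l) / l\<close>; the numerators run through
  \<open>1..p-1\<close> again, and the \<open>p - 1\<close> signs cancel.\<close>

lemma prod_one_minus_p_div: "odd p \<Longrightarrow> (\<Prod>l=1..p-1. 1 - P / of_nat l) = 1"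
proof -
  assume "odd p"
  have "(\<Prod>l=1..p-1. 1 - P / of_nat l) = (\<Prod>l=1..p-1. (-1) * ((P - of_nat l) / of_nat l))"
    by (intro prod.cong) (auto simp: field_simps)
  also have "\<dots> = (-1) ^ (p - 1) * ((\<Prod>l=1..p-1. P - of_nat l) / (\<Prod>l=1..p-1. of_nat l))"
    by (simp only: prod.distrib prod_dividef prod_constant card_atLeastAtMost) simp
  also have "(\<Prod>l=1..p-1. P - of_nat l) = fact (p - 1)"
    using p_pos by (subst prod_diff_fact) simp_all
  also have "(\<Prod>l=1..p-1. of_nat l :: rat) = fact (p - 1)"
    by (simp add: fact_prod)
  finally show ?thesis using \<open>odd p\<close> by simp
qed

text \<open>The value is the binomial coefficient \<open>(2*p - 1) choose (p - 1)\<close>.\<close>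

lemma prod_one_plus_p_div:
  "(\<Prod>l=1..p-1. 1 + P / of_nat l) = fact (2*p - 1) / (fact (p - 1) * fact p)"
proof -
  have "(\<Prod>l=1..p-1. 1 + P / of_nat l) = (\<Prod>l=1..p-1. (P + of_nat l) / of_nat l)"
    by (intro prod.cong) (auto simp: field_simps)
  also have "\<dots> = (fact (p + (p - 1)) / fact p) / fact (p - 1)"
    by (simp only: prod_dividef prod_add_fact) (simp add: fact_prod)
  also have "p + (p - 1) = 2*p - 1" using p_pos by simp
  finally show ?thesis by (simp add: mult.commute)
qed

text \<open>Multiplying by the product of \<open>1 - P / l\<close>, which equals 1, removes the odd
  powers of \<open>P\<close>.\<close>

lemma prod_one_plus_p_div_eq:
  assumes "odd p"
  shows "(\<Prod>l=1..p-1. 1 + P / of_nat l) = (\<Prod>l=1..p-1. 1 - P^2 * (1 / of_nat l)^2)"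
proof -
  have "(\<Prod>l=1..p-1. 1 + P / of_nat l) = (\<Prod>l=1..p-1. 1 + P / of_nat l) * (\<Prod>l=1..p-1. 1 - P / of_nat l)"
    by (simp only: prod_one_minus_p_div[OF assms] mult_1_right)
  also have "\<dots> = (\<Prod>l=1..p-1. 1 - P^2 * (1 / of_nat l)^2)"
    unfolding prod.distrib[symmetric] by (intro prod.cong) (simp_all add: algebra_simps power2_eq_square)
  finally show ?thesis .
qed


text \<open>
  The next two expansions come from summing over \<open>l\<close> and \<open>p - l\<close> and substituting
  \<open>1 / (p - l) = - 1 / l + p / (l (p - l))\<close> repeatedly.
\<close>

lemma hsum1_expand:
  defines "R \<equiv> \<Sum>l=1..p-1. (1 / of_nat l)^4 * (1 / of_nat (p - l)) :: rat"
  shows "2 * hsum 1 (p - 1) = - P * hsum 2 (p - 1) - P^2 * hsum 3 (p - 1) - P^3 * hsum 4 (p - 1) + P^4 * R"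
proof -
  have "2 * hsum 1 (p - 1) = (\<Sum>l=1..p-1. 1 / of_nat l) + (\<Sum>l=1..p-1. 1 / of_nat (p - l))"
    unfolding sum.atLeastAtMost_rev[of "\<lambda>l. 1 / of_nat (p - l)"] using p_pos by (auto simp: hsum_def intro!: sum.cong)
  also have "\<dots> = (\<Sum>l=1..p-1. - P * (1 / of_nat l)^2 - P^2 * (1 / of_nat l)^3 - P^3 * (1 / of_nat l)^4
      + P^4 * ((1 / of_nat l)^4 * (1 / of_nat (p - l))))"
    unfolding sum.distrib[symmetric]
  proof (intro sum.cong refl)
    fix l assume "l \<in> {1..p-1}"
    hence "1 / of_nat (p - l) = - (1 / of_nat l) + P * (1 / of_nat l) * (1 / of_nat (p - l))"
      using p_pos by (intro inverse_reflect) auto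
    thus "1 / of_nat l + 1 / of_nat (p - l) = - P * (1 / of_nat l)^2 - P^2 * (1 / of_nat l)^3 - P^3 * (1 / of_nat l)^4
      + P^4 * ((1 / of_nat l)^4 * (1 / of_nat (p - l)))"
      by algebra
  qed
  also have "\<dots> = - P * hsum 2 (p - 1) - P^2 * hsum 3 (p - 1) - P^3 * hsum 4 (p - 1) + P^4 * R"
    by (simp add: sum.distrib sum_subtractf sum_negf hsum_def R_def sum_distrib_left)
  finally show ?thesis .
qed

lemma hsum3_expand:
  defines "E \<equiv> \<lambda>a b. a * b * a * (6 * a^2 - 4 * a * (P * a * b) + (P * a * b)^2)"
  shows "2 * hsum 3 (p - 1) = P^2 * (\<Sum>l=1..p-1. E (1 / of_nat l) (1 / of_nat (p - l))) - 3 * (P * hsum 4 (p - 1))"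
proof -
  have "2 * hsum 3 (p - 1) = (\<Sum>l=1..p-1. (1 / of_nat l)^3) + (\<Sum>l=1..p-1. (1 / of_nat (p - l))^3)"
    unfolding sum.atLeastAtMost_rev[of "\<lambda>l. (1 / of_nat (p - l))^3"] using p_pos by (auto simp: hsum_def intro!: sum.cong)
  also have "\<dots> = (\<Sum>l=1..p-1. - 3 * P * (1 / of_nat l)^4 + P^2 * E (1 / of_nat l) (1 / of_nat (p - l)))"
    unfolding sum.distrib[symmetric]
  proof (intro sum.cong refl)
    fix l assume "l \<in> {1..p-1}"
    hence "1 / of_nat (p - l) = - (1 / of_nat l) + P * (1 / of_nat l) * (1 / of_nat (p - l))"
      using p_pos by (intro inverse_reflect) auto
    thus "(1 / of_nat l)^3 + (1 / of_nat (p - l))^3 = - 3 * P * (1 / of_nat l)^4 + P^2 * E (1 / of_nat l) (1 / of_nat (p - l))"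
      unfolding E_def by algebra
  qed
  also have "\<dots> = P^2 * (\<Sum>l=1..p-1. E (1 / of_nat l) (1 / of_nat (p - l))) - 3 * (P * hsum 4 (p - 1))"
    by (simp add: sum.distrib sum_subtractf sum_negf hsum_def sum_distrib_left mult.assoc)
  finally show ?thesis .
qed

text \<open>The numbers are 3 and \<open>15 = 3 * 5\<close>, whence the bounds on
  \<open>p\<close>.\<close>

lemma not_dvd_3_15:
  "p > 3 \<Longrightarrow> \<not> p dvd 2^2 - 1" "p > 5 \<Longrightarrow> \<not> p dvd 2^4 - 1"
proof -
  show "p > 3 \<Longrightarrow> \<not> p dvd 2^2 - 1" by (auto dest: dvd_imp_le)
  show "p > 5 \<Longrightarrow> \<not> p dvd 2^4 - 1"
    using prime_dvd_mult_iff[OF prime_p, of 3 5] by (auto dest: dvd_imp_le)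
qed

text \<open>The even sums come from \<open>hsum_even_cong\<close>. In \<open>hsum3_expand\<close>
  the factor \<open>P\<close> before \<open>hsum 4\<close> then gives \<open>p^2\<close>, and in
  \<open>hsum1_expand\<close> everything beyond \<open>P * hsum 2\<close> is divisible by
  \<open>p^4\<close>.\<close>

lemma hsum_cong:
  assumes "p > 5"
  shows "hsum 2 (p - 1) \<in> J 1" "hsum 4 (p - 1) \<in> J 1" "hsum 3 (p - 1) \<in> J 2"
    "2 * hsum 1 (p - 1) + P * hsum 2 (p - 1) \<in> J 4"
proof -
  have odd: "odd p" using assms prime_p prime_odd_nat by auto
  then obtain m where m: "p = 2*m+1" by (elim oddE)
  show h2: "hsum 2 (p - 1) \<in> J 1" using hsum_even_cong[OF m] not_dvd_3_15 assms by simp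
  show h4: "hsum 4 (p - 1) \<in> J 1" using hsum_even_cong[OF m] not_dvd_3_15 assms by simp
  have ab: "1 / of_nat l \<in> J 0" "1 / of_nat (p - l) \<in> J 0" if "l \<in> {1..p-1}" for l
    by (intro inv_J; use that p_pos in auto)+
  have P0: "P \<in> J 0" by simp
  have Ph4: "P * hsum 4 (p - 1) \<in> J 2" using J_P_mult[OF h4] by (simp add: numeral_2_eq_2)
  have "2 * hsum 3 (p - 1) \<in> J 2"
  proof -
    have *: "P^2 * s - 3 * (P * hsum 4 (p - 1)) \<in> J 2" if "s \<in> J 0" for s
      using J_P_power_mult[OF that, of 2] J_numeral_mult[OF Ph4] by (intro J_diff) simp_all
    show ?thesis unfolding hsum3_expand
      by (intro * J_sum J_mult0 J_add J_diff J_power J_numeral P0 ab)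
  qed
  thus h3: "hsum 3 (p - 1) \<in> J 2" using J_half[OF odd] by fastforce
  define R :: rat where "R = (\<Sum>l=1..p-1. (1 / of_nat l)^4 * (1 / of_nat (p - l)))"
  have "R \<in> J 0" unfolding R_def by (intro J_sum J_mult0 J_power ab)
  hence "P^4 * R - P^2 * hsum 3 (p - 1) - P^3 * hsum 4 (p - 1) \<in> J 4"
    using J_P_power_mult[of R 0 4] J_P_power_mult[OF h3, of 2] J_P_power_mult[OF h4, of 3]
    by (intro J_diff) simp_all
  moreover have "2 * hsum 1 (p - 1) + P * hsum 2 (p - 1) = P^4 * R - P^2 * hsum 3 (p - 1) - P^3 * hsum 4 (p - 1)"
    unfolding hsum1_expand R_def by simp
  ultimately show "2 * hsum 1 (p - 1) + P * hsum 2 (p - 1) \<in> J 4" by simp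
qed

text \<open>The power sums in the second-order coefficient \<open>e\<close> are divisible by
  \<open>p\<close>, so \<open>P^4 * e\<close> already lies in \<open>J 5\<close>.\<close>

lemma prod_one_plus_p_div_cong:
  assumes "p > 5"
  shows "(\<Prod>l=1..p-1. 1 + P / of_nat l) - (1 - P^2 * hsum 2 (p - 1)) \<in> J 5"
proof -
  have odd: "odd p" using assms prime_p prime_odd_nat by auto
  define e where "e = (hsum 2 (p - 1) ^ 2 - hsum 4 (p - 1)) / 2"
  have h2: "hsum 2 (p - 1) \<in> J 1" and h4: "hsum 4 (p - 1) \<in> J 1" using hsum_cong[OF assms] by blast+
  have "hsum 2 (p - 1) ^ 2 - hsum 4 (p - 1) \<in> J 1"
    unfolding power2_eq_square using h2 J_mono[OF h2, of 0] by (intro J_diff J_mult0(1) h4) simp_all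
  hence "e \<in> J 1" unfolding e_def by (rule J_half[OF odd])
  hence "P^4 * e \<in> J 5" using J_P_power_mult[of e 1 4] by simp
  moreover have "(\<Prod>l=1..p-1. 1 + P / of_nat l) - (1 - P^2 * hsum 2 (p - 1) + P^4 * e) \<in> J 5"
    unfolding prod_one_plus_p_div_eq[OF odd] e_def
    using J_mono[OF prod_one_minus_square[OF odd, of "p - 1"], of 5] p_pos by simp
  ultimately show ?thesis using J_add by (fastforce simp: algebra_simps)
qed

text \<open>The linear terms of \<open>(1 + 2x)\<^sup>2 (1 - x)\<close> and \<open>(1 + x)\<^sup>3\<close> agree, so the quotient has none.\<close>

lemma wz_factor_cong:
  assumes "1 \<le> l" "l < p"
  defines "x \<equiv> P / of_nat l"
  shows "(1 + 2*x)^2 * (1 - x) / (1 + x)^3 - (1 - 3 * x^2) \<in> J 3"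
    and "(1 - x) / (1 + x)^3 - (1 - 4*x + 9*x^2) \<in> J 3"
    and "(1 - x) / (1 + x)^3 \<in> J 0"
proof -
  have a: "1 / of_nat l \<in> J 0" using assms by (intro inv_J)
  have x_eq: "x = P * (1 / of_nat l)" by (simp add: x_def)
  have x3: "x^3 \<in> J 3"
    unfolding x_eq power_mult_distrib using J_P_power_mult[OF J_power[OF a], of 3 3] by simp
  have x: "x \<in> J 0" unfolding x_eq using a by (intro J_mult0) simp_all
  \<comment> \<open>Since \<open>l + p\<close> is prime to \<open>p\<close>, the number
    \<open>1 / (1 + x) = l / (l + p)\<close> is \<open>p\<close>-integral.\<close>
  have "\<not> p dvd l + p" using not_dvd[OF assms(1,2)] by simp
  hence "of_nat l * (1 / of_nat (l + p)) \<in> J 0" by (intro J_mult0(1) J_inverse) simp_all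
  moreover have "of_nat l * (1 / of_nat (l + p)) = 1 / (1 + x)"
    using assms by (simp add: x_def field_simps)
  ultimately have y: "(1 / (1 + x))^3 \<in> J 0" by (intro J_power) simp
  have "x \<ge> 0" by (simp add: x_def)
  hence nz: "1 + x \<noteq> 0" by simp
  hence nz3: "(1 + x)^3 \<noteq> 0" by simp
  have "(1 + 2*x)^2 * (1 - x) / (1 + x)^3 - (1 - 3 * x^2) = x^3 * (4 + 9*x + 3*x^2) * (1 / (1 + x))^3"
    unfolding power_divide using nz3
    by (simp add: divide_simps) algebra
  thus "(1 + 2*x)^2 * (1 - x) / (1 + x)^3 - (1 - 3 * x^2) \<in> J 3"
    by (simp only:) (intro J_mult0(2) J_add J_power J_numeral x3 x y)
  have "(1 - x) / (1 + x)^3 - (1 - 4*x + 9*x^2) = - (x^3 * (16 + 23*x + 9*x^2) * (1 / (1 + x))^3)"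
    unfolding power_divide using nz3
    by (simp add: divide_simps) algebra
  thus "(1 - x) / (1 + x)^3 - (1 - 4*x + 9*x^2) \<in> J 3"
    by (simp only:) (intro J_uminus J_mult0(2) J_add J_power J_numeral x3 x y)
  have "(1 - x) / (1 + x)^3 = (1 - x) * (1 / (1 + x))^3" by (simp add: power_divide)
  thus "(1 - x) / (1 + x)^3 \<in> J 0"
    using x y by (auto intro!: J_mult0 J_diff)
qed


section \<open>The transformed sums\<close>

text \<open>For odd \<open>p\<close> and \<open>1 \<le> i < p\<close> this is
  \<open>wz_sum_term (p - 1) i\<close> divided by \<open>4 * P^2 * wz_sum_term (p - 1) 0\<close>,
  arranged in powers of \<open>P / l\<close> for expansion factor by factor.\<close>

definition wz_factor :: "nat \<Rightarrow> rat" where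
  "wz_factor i = (1 / of_nat i)^2 * ((1 - P / of_nat i) / (1 + P / of_nat i)^3) *
     (\<Prod>l=1..i-1. (1 + 2 * (P / of_nat l))^2 * (1 - P / of_nat l) / (1 + P / of_nat l)^3)"

lemma wz_factor_Suc:
  assumes "i \<ge> 1"
  shows "wz_factor (Suc i) = wz_factor i * ((2*P + of_nat i)^2 * (of_nat (Suc i) - P) / (P + of_nat (Suc i))^3)"
proof -
  define a :: rat where "a = of_nat i"
  define b :: rat where "b = of_nat (Suc i)"
  have nz: "a > 0" "b > 0" "P > 0" using assms p_pos by (simp_all add: a_def b_def)
  define u where "u = (\<lambda>l::nat. (1 + 2 * (P / of_nat l))^2 * (1 - P / of_nat l) / (1 + P / of_nat l)^3)"
  have *: "(1 / a)^2 * (1 + 2 * (P / a))^2 = (1/a)^2 * (1/a)^2 * (2*P + a)^2"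
    "1 - P / b = (1/b) * (b - P)" "(1 + P / b) = (1/b) * (P + b)"
    using nz by (simp_all add: field_simps)
  have "(\<Prod>l=1..i. u l) = (\<Prod>l=1..i-1. u l) * u i"
    using assms by (cases i) simp_all
  hence "wz_factor (Suc i) = (1/b)^2 * ((1 - P/b) / (1 + P/b)^3) * ((\<Prod>l=1..i-1. u l) * u i)"
    unfolding wz_factor_def u_def b_def by simp
  also have "(1/b)^2 * ((1 - P/b) / (1 + P/b)^3) = (b - P) / (P + b)^3"
  proof -
    have "(1/b)^2 * ((1/b) * (b - P) / ((1/b)^3 * (P + b)^3)) = ((1/b)^3 * (b - P)) / ((1/b)^3 * (P + b)^3)"
      by (simp add: power2_eq_square power3_eq_cube)
    thus ?thesis unfolding * power_mult_distrib using nz by simp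
  qed
  also have "u i = (1/a)^2 * ((1 - P/a) / (1 + P/a)^3) * (2*P + a)^2"
    unfolding u_def a_def[symmetric] using nz by (simp add: field_simps power2_eq_square)
  also have "(b - P) / (P + b)^3 * ((\<Prod>l=1..i-1. u l) * \<dots>) =
      ((1/a)^2 * ((1 - P/a) / (1 + P/a)^3) * (\<Prod>l=1..i-1. u l)) * ((2*P + a)^2 * (b - P) / (P + b)^3)"
    by (simp add: mult_ac)
  also have "(1/a)^2 * ((1 - P/a) / (1 + P/a)^3) * (\<Prod>l=1..i-1. u l) = wz_factor i"
    by (simp add: wz_factor_def u_def a_def)
  finally show ?thesis by (simp only: a_def b_def)
qed

text \<open>Comparing factorials, the quotient by the fifth power of the binomial coefficient is
  \<open>32 * (p! / (p-1)!)^2\<close>.\<close>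

lemma wz_sum_term_0:
  assumes "odd p"
  shows "wz_sum_term (p - 1) 0 = 32 * P^2 * (\<Prod>l=1..p-1. 1 + P / of_nat l)^5"
proof -
  define A :: rat where "A = fact (2*p - 1)"
  define B :: rat where "B = fact (p - 1)"
  have B: "B \<noteq> 0" "P \<noteq> 0" using p_pos by (simp_all add: B_def)
  have f: "fact p = P * B" using p_pos by (simp add: B_def fact_reduce)
  have i: "2 * (p - 1) + 1 = 2*p - 1" "2 * (p - 1) + 0 + 1 = 2*p - 1" "p - 1 + 1 + 0 = p" "p - 1 - 0 = p - 1" "p - 1 + 0 = p - 1"
    using p_pos by simp_all
  have "(-1) ^ (p - 1) = (1::rat)" using assms by simp
  hence "wz_sum_term (p - 1) 0 = 32 * A^3 * A^2 / (B^6 * B * (P * B)^3)"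
    unfolding wz_sum_term_def i A_def[symmetric] B_def[symmetric] f by simp
  also have "\<dots> = 32 * P^2 * (A / (B * (P * B)))^5"
    using B by (simp add: field_simps flip: power_Suc)
  finally show ?thesis unfolding prod_one_plus_p_div A_def B_def[symmetric] f .
qed

text \<open>The ratio from \<open>i = 0\<close> to \<open>i = 1\<close> contains
  \<open>(2*P)^2\<close>, which turns \<open>32 * P^2\<close> into \<open>128 * P^4\<close>. The
  later ratios are those of \<open>wz_factor_Suc\<close>.\<close>

lemma wz_sum_term_eq:
  assumes "odd p" "1 \<le> i" "i < p"
  shows "wz_sum_term (p - 1) i = 128 * P^4 * (\<Prod>l=1..p-1. 1 + P / of_nat l)^5 * wz_factor i"
  using assms(2,3)
proof (induction i rule: dec_induct)
  case base
  have "wz_sum_term (p - 1) (Suc 0) = - (32 * P^2 * (\<Prod>l=1..p-1. 1 + P / of_nat l)^5) *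
      ((2 * P)^2 * (P - 1) / (P + 1)^3)"
    using wz_sum_term_Suc[of 0 "p - 1"] base unfolding wz_sum_term_0[OF assms(1)]
    by (simp add: of_nat_diff add_ac)
  thus ?case by (simp add: wz_factor_def power_mult_distrib field_simps flip: power_add)
next
  case (step i)
  have "of_nat (2 * (p - 1) + i + 2) = 2*P + of_nat i" "of_nat (p - 1 - i) = P - of_nat (Suc i)"
    "of_nat (p - 1 + i + 2) = P + of_nat (Suc i)"
    using step.prems by (simp_all add: of_nat_diff)
  hence "wz_sum_term (p - 1) (Suc i) = - wz_sum_term (p - 1) i *
      ((2*P + of_nat i)^2 * (P - of_nat (Suc i)) / (P + of_nat (Suc i))^3)"
    using wz_sum_term_Suc[of i "p - 1"] step.prems by (simp only:)
  also have "\<dots> = wz_sum_term (p - 1) i *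
      ((2*P + of_nat i)^2 * (of_nat (Suc i) - P) / (P + of_nat (Suc i))^3)"
    by (simp only: minus_diff_eq[of "of_nat (Suc i)" P, symmetric] mult_minus_right minus_divide_left[symmetric] minus_mult_minus)
  also have "wz_sum_term (p - 1) i = 128 * P^4 * (\<Prod>l=1..p-1. 1 + P / of_nat l)^5 * wz_factor i"
    using step by simp
  finally show ?case unfolding wz_factor_Suc[OF step.hyps(1)] by (simp only: mult.assoc)
qed

text \<open>Without linear terms, the quadratic terms of the factors simply add up; cross terms
  carry \<open>P^4\<close>.\<close>

lemma prod_wz_factor_cong:
  "n < p \<Longrightarrow> (\<Prod>l=1..n. (1 + 2 * (P / of_nat l))^2 * (1 - P / of_nat l) / (1 + P / of_nat l)^3)
     - (1 - 3 * P^2 * hsum 2 n) \<in> J 3"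
proof (induction n)
  case (Suc n)
  define u where "u = (\<lambda>l::nat. (1 + 2 * (P / of_nat l))^2 * (1 - P / of_nat l) / (1 + P / of_nat l)^3)"
  define x :: rat where "x = (1 / of_nat (Suc n))^2"
  define h where "h = hsum 2 n"
  have a: "1 / of_nat (Suc n) \<in> J 0" using Suc.prems by (intro inv_J) auto
  hence x: "x \<in> J 0" unfolding x_def by (rule J_power)
  have h: "h \<in> J 0" using Suc.prems by (simp add: h_def hsum_J)
  have u: "u (Suc n) - (1 - 3 * (P^2 * x)) \<in> J 3"
    using wz_factor_cong(1)[of "Suc n"] Suc.prems unfolding u_def x_def by (simp add: power_divide)
  have P0: "P \<in> J 0" by simp
  have c: "1 - 3 * (P^2 * x) \<in> J 0" "1 - 3 * P^2 * h \<in> J 0"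
    using x h P0 by (auto intro!: J_diff J_mult0 J_power)
  have "u (Suc n) \<in> J 0" by (rule J_cong_integral[OF u c(1)])
  hence "(\<Prod>l=1..n. u l) * u (Suc n) - (1 - 3 * P^2 * h) * (1 - 3 * (P^2 * x)) \<in> J 3"
    using Suc c u by (intro J_cong_mult) (simp_all add: u_def h_def)
  moreover have "(1 - 3 * P^2 * h) * (1 - 3 * (P^2 * x)) - (1 - 3 * P^2 * (h + x)) \<in> J 3"
  proof -
    have "(1 - 3 * P^2 * h) * (1 - 3 * (P^2 * x)) - (1 - 3 * P^2 * (h + x)) = P^4 * (9 * h * x)"
      by algebra
    moreover have "9 * h * x \<in> J 0" using h x by (intro J_mult0 J_numeral)
    hence "P^4 * (9 * h * x) \<in> J 3" by (intro J_mono[OF J_P_power_mult[of "9 * h * x" 0 4], of 3]) simp_all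
    ultimately show ?thesis by simp
  qed
  ultimately have "(\<Prod>l=1..n. u l) * u (Suc n) - (1 - 3 * P^2 * (h + x)) \<in> J 3" by (rule J_trans)
  moreover have "hsum 2 (Suc n) = h + x" by (simp add: hsum_Suc h_def x_def)
  ultimately show ?case by (simp add: u_def)
qed simp

text \<open>The corrections to \<open>hsum 2\<close> are multiples of \<open>P * hsum 3\<close>,
  \<open>P^2 * hsum 4\<close> and \<open>P^2 * e\<close>; each lies in \<open>J 3\<close> by
  \<open>hsum_cong\<close>.\<close>

lemma sum_wz_factor_cong:
  assumes "p > 5"
  shows "(\<Sum>i=1..p-1. wz_factor i) - hsum 2 (p - 1) \<in> J 3"
proof -
  have odd: "odd p" using assms prime_p prime_odd_nat by auto
  have P0: "P \<in> J 0" by simp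
  \<comment> \<open>This is \<open>1 / i^2\<close> times the truncations from
    \<open>wz_factor_cong\<close> and \<open>prod_wz_factor_cong\<close>, multiplied out with
    \<open>P^3\<close> and higher dropped.\<close>
  define v :: "nat \<Rightarrow> rat" where "v = (\<lambda>i. (1 / of_nat i)^2 - 4 * P * (1 / of_nat i)^3 + 9 * P^2 * (1 / of_nat i)^4
     - 3 * P^2 * ((1 / of_nat i)^2 * hsum 2 (i - 1)))"
  have "wz_factor i - v i \<in> J 3" if i: "i \<in> {1..p-1}" for i
  proof -
    define a :: rat where "a = 1 / of_nat i"
    define h where "h = hsum 2 (i - 1)"
    have i': "1 \<le> i" "i < p" "i - 1 < p" using i by auto
    have a: "a \<in> J 0" and h: "h \<in> J 0" using i' by (simp_all add: a_def h_def inv_J hsum_J)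
    have x: "P / of_nat i = P * a" by (simp add: a_def)
    note c = wz_factor_cong(2,3)[OF i'(1,2), unfolded x]
    note d = prod_wz_factor_cong[OF i'(3), folded h_def]
    have w0: "1 - 4 * (P * a) + 9 * (P * a)^2 \<in> J 0" and d0: "1 - 3 * P^2 * h \<in> J 0"
      using a h P0 by (auto intro!: J_add J_diff J_mult0 J_power)
    define W where "W = (1 - P * a) / (1 + P * a)^3"
    define U where "U = (\<Prod>l=1..i-1. (1 + 2 * (P / of_nat l))^2 * (1 - P / of_nat l) / (1 + P / of_nat l)^3)"
    have "U \<in> J 0" unfolding U_def by (rule J_cong_integral[OF d d0])
    hence "W * U - (1 - 4 * (P * a) + 9 * (P * a)^2) * (1 - 3 * P^2 * h) \<in> J 3"
      unfolding W_def U_def using c d w0 by (intro J_cong_mult) simp_all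
    hence 1: "a^2 * (W * U - (1 - 4 * (P * a) + 9 * (P * a)^2) * (1 - 3 * P^2 * h)) \<in> J 3"
      using a by (intro J_mult0(1) J_power)
    have "12 * a^3 * h - 27 * P * a^4 * h \<in> J 0"
      using a h P0 by (auto intro!: J_diff J_mult0 J_power)
    hence 2: "P^3 * (12 * a^3 * h - 27 * P * a^4 * h) \<in> J 3"
      using J_P_power_mult[of _ 0 3] by simp
    have "wz_factor i = a^2 * W * U"
      unfolding wz_factor_def W_def U_def x a_def ..
    moreover have "v i = a^2 - 4 * P * a^3 + 9 * P^2 * a^4 - 3 * P^2 * (a^2 * h)"
      by (simp add: v_def a_def h_def)
    ultimately have "wz_factor i - v i = a^2 * (W * U - (1 - 4 * (P * a) + 9 * (P * a)^2) * (1 - 3 * P^2 * h))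
       + P^3 * (12 * a^3 * h - 27 * P * a^4 * h)"
      by algebra
    thus ?thesis using J_add[OF 1 2] by simp
  qed
  hence "(\<Sum>i=1..p-1. wz_factor i - v i) \<in> J 3" by (rule J_sum)
  hence 1: "(\<Sum>i=1..p-1. wz_factor i) - (\<Sum>i=1..p-1. v i) \<in> J 3" by (simp add: sum_subtractf)
  define e where "e = (hsum 2 (p - 1) ^ 2 - hsum 4 (p - 1)) / 2"
  note hs = hsum_cong[OF assms]
  have "(\<Sum>i=1..p-1. v i) = hsum 2 (p - 1) - 4 * P * hsum 3 (p - 1) + 9 * P^2 * hsum 4 (p - 1) - 3 * P^2 * e"
    unfolding v_def sum_subtractf sum.distrib sum_distrib_left[symmetric] sum_hsum2_div_square
    by (simp add: hsum_def e_def)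
  hence V: "(\<Sum>i=1..p-1. v i) - hsum 2 (p - 1) =
      9 * (P^2 * hsum 4 (p - 1)) - 3 * (P^2 * e) - 4 * (P * hsum 3 (p - 1))"
    by algebra
  have "hsum 2 (p - 1) ^ 2 - hsum 4 (p - 1) \<in> J 1"
    unfolding power2_eq_square using hs J_mono[OF hs(1), of 0] by (intro J_diff J_mult0(1)) simp_all
  hence "e \<in> J 1" unfolding e_def by (rule J_half[OF odd])
  hence "9 * (P^2 * hsum 4 (p - 1)) - 3 * (P^2 * e) - 4 * (P * hsum 3 (p - 1)) \<in> J 3"
    using J_P_power_mult[of e 1 2] J_P_power_mult[of _ 1 2, OF hs(2)] J_P_power_mult[of _ 2 1, OF hs(3)]
    by (intro J_diff J_numeral_mult) (simp_all flip: numeral_3_eq_3)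
  hence "(\<Sum>i=1..p-1. v i) - hsum 2 (p - 1) \<in> J 3" unfolding V .
  with 1 show ?thesis by (rule J_trans)
qed

section \<open>The full sum modulo \<open>p^7\<close>\<close>

lemma full_sum_cong:
  assumes "p > 5"
  shows "(\<Sum>i\<le>p-1. wz_sum_term (p - 1) i) - (32 * P^2 + 64 * P^3 * hsum 1 (p - 1)) \<in> J 7"
proof -
  have odd: "odd p" using assms prime_p prime_odd_nat by auto
  define C where "C = (\<Prod>l=1..p-1. 1 + P / of_nat l)"
  define T where "T = (\<Sum>i=1..p-1. wz_factor i)"
  define h where "h = hsum 2 (p - 1)"
  define x where "x = P^2 * h"
  have h: "h \<in> J 1" using hsum_cong[OF assms] by (simp add: h_def)
  have x3: "x \<in> J 3" using J_P_power_mult[OF h, of 2] by (simp add: x_def)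
  have x0: "x \<in> J 0" using J_mono[OF x3] by simp
  have P0: "P \<in> J 0" by simp
  have "(\<Sum>i\<le>p-1. wz_sum_term (p - 1) i) = wz_sum_term (p - 1) 0 + (\<Sum>i=1..p-1. wz_sum_term (p - 1) i)"
  proof -
    have "{..p-1} = insert 0 {1..p-1}" by auto
    thus ?thesis by simp
  qed
  also have "(\<Sum>i=1..p-1. wz_sum_term (p - 1) i) = 128 * P^4 * C^5 * T"
    unfolding T_def sum_distrib_left C_def by (intro sum.cong refl wz_sum_term_eq odd) auto
  \<comment> \<open>The common factor \<open>P^2\<close> supplies two powers of \<open>p\<close>, so
    the rest is needed only modulo \<open>p^5\<close>.\<close>
  finally have S: "(\<Sum>i\<le>p-1. wz_sum_term (p - 1) i) = 32 * P^2 * (C^5 * (1 + 4 * (P^2 * T)))"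
    unfolding wz_sum_term_0[OF odd] C_def[symmetric] by algebra
  have C: "C - (1 - x) \<in> J 5"
    using prod_one_plus_p_div_cong[OF assms] by (simp add: C_def x_def h_def)
  have T: "T - h \<in> J 3" using sum_wz_factor_cong[OF assms] by (simp add: T_def h_def)
  have "P^2 * (T - h) \<in> J 5" using J_P_power_mult[OF T, of 2] by simp
  hence "4 * (P^2 * (T - h)) \<in> J 5" by (rule J_numeral_mult)
  moreover have "(1 + 4 * (P^2 * T)) - (1 + 4 * x) = 4 * (P^2 * (T - h))" by (simp add: x_def algebra_simps)
  ultimately have T': "(1 + 4 * (P^2 * T)) - (1 + 4 * x) \<in> J 5" by simp
  have C0: "C \<in> J 0" by (rule J_cong_integral[OF C J_diff[OF J_one x0]])
  have T0: "1 + 4 * (P^2 * T) \<in> J 0"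
    by (rule J_cong_integral[OF T' J_add[OF J_one J_numeral_mult[OF x0]]])
  have "C^5 * (1 + 4 * (P^2 * T)) - (1 - x)^5 * (1 + 4 * x) \<in> J 5"
    by (intro J_cong_mult J_cong_power C T' T0 C0 J_power J_diff x0 J_one)
  \<comment> \<open>The linear terms give \<open>4*x - 5*x = -x\<close>; the remainder has the
    factor \<open>x^2\<close>, which lies in \<open>J 6\<close>.\<close>
  moreover have "(1 - x)^5 * (1 + 4 * x) - (1 - x) \<in> J 5"
  proof -
    have "(1 - x)^5 * (1 + 4 * x) - (1 - x) = (x * x) * ((1 - x) * (4 * x^3 - 15 * x^2 + 20 * x - 10))"
      by algebra
    moreover have "x * x \<in> J 6" using J_mult[OF x3 x3] by simp
    hence xx: "x * x \<in> J 5" by (rule J_mono) simp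
    ultimately show ?thesis
      by (simp only:) (intro J_mult0(2)[OF xx] J_mult0(2)[of _ 0] J_add J_diff J_power J_numeral J_one x0)
  qed
  ultimately have "C^5 * (1 + 4 * (P^2 * T)) - (1 - x) \<in> J 5" by (rule J_trans)
  \<comment> \<open>Here \<open>x = P * (P * h)\<close>, and \<open>P * h\<close> is
    \<open>-2 * hsum 1 (p - 1)\<close> modulo \<open>p^4\<close>.\<close>
  moreover have "(1 - x) - (1 + 2 * P * hsum 1 (p - 1)) \<in> J 5"
  proof -
    have "P * (2 * hsum 1 (p - 1) + P * h) \<in> J 5"
      using J_P_mult[OF hsum_cong(4)[OF assms]] by (simp add: h_def)
    hence "- (P * (2 * hsum 1 (p - 1) + P * h)) \<in> J 5" by (rule J_uminus)
    thus ?thesis by (simp add: x_def algebra_simps power2_eq_square)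
  qed
  ultimately have "C^5 * (1 + 4 * (P^2 * T)) - (1 + 2 * P * hsum 1 (p - 1)) \<in> J 5" by (rule J_trans)
  hence "P^2 * (C^5 * (1 + 4 * (P^2 * T)) - (1 + 2 * P * hsum 1 (p - 1))) \<in> J 7"
    using J_P_power_mult[of _ 5 2] by simp
  hence "32 * (P^2 * (C^5 * (1 + 4 * (P^2 * T)) - (1 + 2 * P * hsum 1 (p - 1)))) \<in> J 7"
    by (rule J_numeral_mult)
  moreover have "32 * (P^2 * (C^5 * (1 + 4 * (P^2 * T)) - (1 + 2 * P * hsum 1 (p - 1)))) =
    32 * P^2 * (C^5 * (1 + 4 * (P^2 * T))) - (32 * P^2 + 64 * P^3 * hsum 1 (p - 1))"
    by algebra
  ultimately show ?thesis unfolding S by simp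
qed

section \<open>The half sum modulo \<open>p^5\<close>\<close>

lemma half_sum_cong:
  assumes "p > 3" "p = 2*m+1"
  shows "(\<Sum>i\<le>m. wz_sum_term m i) - 32 * P^2 \<in> J 5"
proof -
  have odd: "odd p" using assms by simp
  have mp: "m < p" using assms by simp
  \<comment> \<open>The numerator has five factorials \<open>p!\<close> or \<open>(p + i)!\<close>,
    each divisible by \<open>p\<close>; for \<open>i < m\<close> the denominator has only factorials
    of numbers below \<open>p\<close>.\<close>
  have "wz_sum_term m i \<in> J 5" if "i < m" for i
  proof -
    have fP: "fact (p + k) = P * of_nat (fact (p + k) div p)" for k
      using dvd_fact[of p "p + k"] p_pos by (simp flip: of_nat_mult)
    define a where "a = (of_nat (fact p div p) :: rat)"
    define b where "b = (of_nat (fact (p + i) div p) :: rat)"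
    have n: "2*m+1 = p" "2*m+i+1 = p + i" using assms by simp_all
    have "wz_sum_term m i = 32 * (-1) ^ (m + i) * fact p ^ 3 * fact (p + i) ^ 2 /
       (fact m ^ 6 * fact (m - i) * fact (m + 1 + i) ^ 3)"
      unfolding wz_sum_term_def n by (rule refl)
    also have "\<dots> = P^5 * (32 * (-1) ^ (m + i) * a^3 * b^2 *
        (1 / fact m) ^ 6 * (1 / fact (m - i)) * (1 / fact (m + 1 + i)) ^ 3)"
      using fP[of i] fP[of 0] by (simp add: a_def b_def power_mult_distrib power_divide flip: power_add)
    finally have eq: "wz_sum_term m i = \<dots>" .
    have *: "a \<in> J 0" "b \<in> J 0" "-1 \<in> J 0" using J_of_int[of "-1"] by (simp_all add: a_def b_def)
    have "32 * (-1) ^ (m + i) * a^3 * b^2 *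
        (1 / fact m) ^ 6 * (1 / fact (m - i)) * (1 / fact (m + 1 + i)) ^ 3 \<in> J 0"
      by (intro J_mult0 J_power inv_fact_J J_numeral *; use that assms in linarith)
    from J_P_power_mult[OF this, of 5] show ?thesis unfolding eq by (simp only: add_0_right)
  qed
  hence "(\<Sum>i<m. wz_sum_term m i) \<in> J 5" by (intro J_sum) simp
  \<comment> \<open>At \<open>i = m\<close> the denominator contains
    \<open>(m + 1 + m)!^3 = p!^3\<close>, which cancels three of the five and leaves
    \<open>p^2\<close>.\<close>
  moreover have "wz_sum_term m m - 32 * P^2 \<in> J 5"
  proof -
    define D where "D = (\<Prod>l=1..m. 1 - P^2 * (1 / of_nat l)^2)"
    define h where "h = hsum 2 m"
    define e where "e = (hsum 2 m ^ 2 - hsum 4 m) / 2"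
    have h: "h \<in> J 1" unfolding h_def using hsum_even_cong(1)[OF assms(2)] not_dvd_3_15(1)[OF assms(1)] by simp
    have "e \<in> J 0"
      unfolding e_def by (intro J_half odd J_diff J_power hsum_J mp)
    hence c1: "P^4 * e \<in> J 3" using J_mono[OF J_P_power_mult[of e 0 4], of 3] by simp
    have c2: "P^2 * h \<in> J 3" using J_P_power_mult[OF h, of 2] by simp
    have c3: "D - (1 - P^2 * h + P^4 * e) \<in> J 3"
      using J_mono[OF prod_one_minus_square[OF odd mp], of 3] by (simp add: D_def h_def e_def)
    have D: "D - 1 \<in> J 3"
      using J_add[OF J_diff[OF c3 c2] c1] by (simp add: algebra_simps)
    hence "D \<in> J 0" using J_cong_integral J_one by blast
    hence "D ^ 2 - 1 ^ 2 \<in> J 3" by (intro J_cong_power D J_one)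
    hence "P^2 * (D ^ 2 - 1) \<in> J 5" using J_P_power_mult[of "D^2 - 1" 3 2] by simp
    hence "32 * (P^2 * (D ^ 2 - 1)) \<in> J 5" by (rule J_numeral_mult)
    moreover have "wz_sum_term m m = 32 * P^2 * D^2"
    proof -
      have n: "2*m+1 = p" "2*m+m+1 = p + m" "m+1+m = p" "p - 1 - m = m" using assms by simp_all
      \<comment> \<open>Evaluating the product of \<open>p^2 - l^2\<close> in two ways expresses
        \<open>(p + m)!\<close> through \<open>D\<close>.\<close>
      have "(\<Prod>l=1..m. (P - of_nat l) * (P + of_nat l)) = (-1)^m * fact m ^ 2 * D"
        unfolding D_def
      proof (induction m)
        case (Suc m)
        have "(P - of_nat (Suc m)) * (P + of_nat (Suc m)) =
           - (of_nat (Suc m)^2 * (1 - P^2 * (1 / of_nat (Suc m))^2))"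
          by (simp add: field_simps power2_eq_square del: of_nat_Suc)
        thus ?case using Suc by (simp add: power_mult_distrib mult_ac del: of_nat_Suc)
      qed simp
      moreover have "(\<Prod>l=1..m. (P - of_nat l) * (P + of_nat l)) = fact (p - 1) / fact m * (fact (p + m) / fact p)"
        unfolding prod.distrib prod_diff_fact[OF mp] prod_add_fact n ..
      moreover have "fact p = P * (fact (p - 1) :: rat)" using p_pos by (simp add: fact_reduce)
      ultimately have f: "fact (p + m) = (-1)^m * P * fact m ^ 3 * D"
        using p_pos by (simp add: field_simps power2_eq_square power3_eq_cube)
      have "(-1) ^ (m + m) = (1 :: rat)" by (simp flip: mult_2)
      hence "wz_sum_term m m = 32 * fact (p + m)^2 / fact m ^ 6"
        unfolding wz_sum_term_def n by simp
      also have "\<dots> = 32 * P^2 * D^2"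
        unfolding f by (simp add: power_mult_distrib flip: power_mult)
      finally show ?thesis .
    qed
    ultimately show ?thesis by (simp add: algebra_simps)
  qed
  ultimately have "(\<Sum>i<m. wz_sum_term m i) + (wz_sum_term m m - 32 * P^2) \<in> J 5" by (rule J_add)
  thus ?thesis by (simp add: lessThan_Suc_atMost[symmetric] algebra_simps)
qed

end

lemma harm_eq_hsum: "harm n = hsum 1 n"
  by (simp add: harm_def hsum_def)

theorem theorem8:
  fixes p :: nat
  assumes "prime p" and "odd p"
  shows "(p \<noteq> 5 \<longrightarrow>
           qcong_pow p 7
             (\<Sum>k=0..p-1. of_nat (205*k^2 + 160*k + 32) * (-1)^k * (of_nat ((2*k) choose k))^5)
             (32 * of_nat p ^ 2 + 64 * of_nat p ^ 3 * harm (p - 1)))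
       \<and> (p > 3 \<longrightarrow>
           qcong_pow p 5
             (\<Sum>k=0..(p-1) div 2. of_nat (205*k^2 + 160*k + 32) * (-1)^k * (of_nat ((2*k) choose k))^5)
             (32 * of_nat p ^ 2))"
proof (intro conjI impI)
  interpret padic p by unfold_locales fact
  show "qcong_pow p 7
       (\<Sum>k=0..p-1. of_nat (205*k^2 + 160*k + 32) * (-1)^k * (of_nat ((2*k) choose k))^5)
       (32 * of_nat p ^ 2 + 64 * of_nat p ^ 3 * harm (p - 1))" if "p \<noteq> 5"
  proof (cases "p = 3")
    case True
    \<comment> \<open>The power sum congruences require \<open>p > 5\<close>, so 3 is checked by
      evaluation; 4160 is the difference divided by \<open>3^7\<close>.\<close>
    have "(\<Sum>k=0..p-1. of_nat (205*k^2 + 160*k + 32) * (-1)^k * (of_nat ((2*k) choose k))^5)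
      - (32 * P ^ 2 + 64 * P ^ 3 * harm (p - 1)) = P ^ 7 * 4160"
      by (simp add: True harm_def numeral_2_eq_2 numeral_eq_Suc)
    moreover have "P ^ 7 * 4160 \<in> J 7" by (intro J_mult0(2)) simp_all
    ultimately show ?thesis unfolding qcong_pow_iff by (simp only:)
  next
    case False
    have "p \<ge> 2" "p \<noteq> 2" "p \<noteq> 4" using prime_ge_2_nat[OF prime_p] assms by auto
    hence "p > 5" using False that by linarith
    thus ?thesis unfolding qcong_pow_iff sum_eq_wz_sum harm_eq_hsum by (rule full_sum_cong)
  qed
  show "qcong_pow p 5
       (\<Sum>k=0..(p-1) div 2. of_nat (205*k^2 + 160*k + 32) * (-1)^k * (of_nat ((2*k) choose k))^5)
       (32 * of_nat p ^ 2)" if "p > 3"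
    unfolding qcong_pow_iff sum_eq_wz_sum
    by (rule half_sum_cong) (use that assms in auto)
qed

end
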